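(* Let $X$ be a normed space over $\mathbb{F}\in\{\mathbb{R},\mathbb{C}\}$ of dimension at least 2. Then the numerical radius parallelism relation $\parallel_v$ in $\mathbb{B}(X)$ does not coincide with linear dependence; that is, there exist linearly independent operators $T,S\in\mathbb{B}(X)$ such that $T\parallel_v S$.
   Context: $\mathbb{B}(X)$ is the space of bounded linear operators $X\to X$; $S_X$ is the unit sphere of $X$ and $S_{X^*}$ that of its dual $X^*$; $\mathbb{T}=\{\lambda\in\mathbb{F}:|\lambda|=1\}$. For $x\in X$, $J(x)=\{x^*\in S_{X^*}: x^*(x)=\|x\|\}$. The numerical radius of $T\in\mathbb{B}(X)$ is $v(T)=\sup\{|x^*(Tx)|: x\in S_X,\ x^*\in J(x)\}$. $T$ is numerical radius parallel to $S$, written $T\parallel_v S$, if $v(T+\lambda S)=v(T)+v(S)$ for some $\lambda\in\mathbb{T}$. (Linearly dependent operators are always numerical radius parallel.) *)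

theory Defs
  imports "HOL-Analysis.Analysis"
begin

text \<open>
  HOL-Analysis has real normed spaces (class \<open>real_normed_vector\<close>) but no complex ones.
  A normed space over \<open>'f\<close> is given here as a type of that class together with a scalar
  multiplication by \<open>'f\<close> that extends the real one and is compatible with the norm.
  It is used with \<open>'f\<close> = \<open>real\<close> and \<open>'f\<close> = \<open>complex\<close> only.  Completeness is not assumed.
\<close>

locale normed_space_over = vector_space scale
  for scale :: "'f::real_normed_field \<Rightarrow> 'a::real_normed_vector \<Rightarrow> 'a" +
  assumes scale_of_real: "scale (of_real r) x = r *\<^sub>R x"
    and norm_scale: "norm (scale c x) = norm c * norm x"
begin

text \<open>Infinite bases are listed separately because \<open>card\<close> (and hence \<open>dim\<close>) is 0 for them.\<close>

definition dimension_at_least :: "nat \<Rightarrow> bool" where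
  "dimension_at_least n \<longleftrightarrow>
    (\<exists>B. independent B \<and> span B = UNIV \<and> (infinite B \<or> n \<le> card B))"

definition bounded_operators :: "('a \<Rightarrow> 'a) set" where
  "bounded_operators =
    {T. Vector_Spaces.linear scale scale T \<and> (\<exists>K. \<forall>x. norm (T x) \<le> norm x * K)}"

definition dual :: "('a \<Rightarrow> 'f) set" where
  "dual = {f. Vector_Spaces.linear scale (*) f \<and> (\<exists>K. \<forall>x. norm (f x) \<le> norm x * K)}"

definition support_functionals :: "'a \<Rightarrow> ('a \<Rightarrow> 'f) set" where
  "support_functionals x = {f \<in> dual. onorm f = 1 \<and> f x = of_real (norm x)}"

text \<open>
  For bounded \<open>T\<close> on a nonzero space the set below is bounded and (by Hahn-Banach) nonempty, so the
  real-valued \<open>Sup\<close> is the genuine supremum.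
\<close>

definition numerical_radius :: "('a \<Rightarrow> 'a) \<Rightarrow> real" where
  "numerical_radius T = Sup {norm (f (T x)) | x f. norm x = 1 \<and> f \<in> support_functionals x}"

definition numerical_radius_parallel :: "('a \<Rightarrow> 'a) \<Rightarrow> ('a \<Rightarrow> 'a) \<Rightarrow> bool" where
  "numerical_radius_parallel T S \<longleftrightarrow>
    (\<exists>l. norm l = 1 \<and>
      numerical_radius (\<lambda>x. T x + scale l (S x)) = numerical_radius T + numerical_radius S)"

definition linearly_independent_pair :: "('a \<Rightarrow> 'a) \<Rightarrow> ('a \<Rightarrow> 'a) \<Rightarrow> bool" where
  "linearly_independent_pair T S \<longleftrightarrow>
    (\<forall>a b. (\<forall>x. scale a (T x) + scale b (S x) = 0) \<longrightarrow> a = 0 \<and> b = 0)"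

end

lemma normed_space_over_scaleR:
  "normed_space_over (scaleR :: real \<Rightarrow> 'a::real_normed_vector \<Rightarrow> 'a)"
  by unfold_locales (auto simp: algebra_simps)

lemma normed_space_over_complex: "normed_space_over ((*) :: complex \<Rightarrow> complex \<Rightarrow> complex)"
  by unfold_locales (auto simp: algebra_simps norm_mult scaleR_conv_of_real)

end

theory Submission
  imports Defs
begin

text \<open>
  If \<open>f\<close> is a support functional at a unit vector \<open>x\<close>, then the identity and the rank-one operator
  \<open>y \<mapsto> f(y) x\<close> both have numerical radius 1 and both attain it at the pair \<open>(x, f)\<close> with value 1, so
  their sum has numerical radius 2.  In dimension at least 2 they are linearly independent.  The
  functional \<open>f\<close> comes from the Hahn-Banach theorem: by Zorn's lemma there is a minimal sublinear
  functional below \<open>z \<mapsto> inf {\<parallel>z + t x\<parallel> - t \<parallel>x\<parallel> | t \<ge> 0}\<close>, and minimal sublinear functionals are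
  linear.
\<close>

section \<open>Sublinear functionals and the Hahn-Banach theorem over the reals\<close>

definition sublinear :: "('a::real_vector \<Rightarrow> real) \<Rightarrow> bool" where
  "sublinear p \<longleftrightarrow> (\<forall>x y. p (x + y) \<le> p x + p y) \<and> (\<forall>t>0. \<forall>x. p (t *\<^sub>R x) \<le> t * p x)"

text \<open>For sublinear \<open>p\<close> this is the largest sublinear functional below
  \<open>p\<close> whose value at \<open>- y\<close> is at most \<open>- p y\<close>.\<close>

definition lowered :: "('a::real_vector \<Rightarrow> real) \<Rightarrow> 'a \<Rightarrow> 'a \<Rightarrow> real" where
  "lowered p y z = (INF t\<in>{0..}. p (z + t *\<^sub>R y) - t * p y)"

lemma sublinear_add: "sublinear p \<Longrightarrow> p (x + y) \<le> p x + p y"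
  by (simp add: sublinear_def)

lemma sublinear_scaleR_le: "sublinear p \<Longrightarrow> 0 < t \<Longrightarrow> p (t *\<^sub>R x) \<le> t * p x"
  by (simp add: sublinear_def)

lemma sublinear_zero:
  assumes "sublinear p"
  shows "p 0 = 0"
  using sublinear_add[OF assms, of 0 0] sublinear_scaleR_le[OF assms, of "1/2" 0] by simp

text \<open>The defining inequality at \<open>t *\<^sub>R x\<close> with factor 1/t gives the
  reverse bound, so homogeneity is an equality.\<close>

lemma sublinear_scaleR:
  assumes "sublinear p" "0 \<le> t"
  shows "p (t *\<^sub>R x) = t * p x"
proof (cases "t = 0")
  case True
  then show ?thesis using sublinear_zero[OF assms(1)] by simp
next
  case False
  then have t: "t > 0" using assms by simp
  have "p (inverse t *\<^sub>R (t *\<^sub>R x)) \<le> inverse t * p (t *\<^sub>R x)"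
    using t by (intro sublinear_scaleR_le[OF assms(1)]) simp
  then have "t * p x \<le> p (t *\<^sub>R x)" using t by (simp add: field_simps)
  then show ?thesis using sublinear_scaleR_le[OF assms(1) t, of x] by simp
qed

lemma sublinear_minus: "sublinear p \<Longrightarrow> - p (- x) \<le> p x"
  using sublinear_add[of p x "- x"] sublinear_zero[of p] by simp

lemma sublinear_norm: "sublinear norm"
  by (simp add: sublinear_def norm_triangle_ineq)

text \<open>Subadditivity for t y = (z + t y) + (-z) gives a bound independent of t, so the infimum
  is genuine.\<close>

lemma lowered_bdd:
  assumes "sublinear p"
  shows "bdd_below ((\<lambda>t. p (z + t *\<^sub>R y) - t * p y) ` {0..})"
proof (rule bdd_belowI2)
  fix t :: real assume "t \<in> {0..}"
  then show "- p (- z) \<le> p (z + t *\<^sub>R y) - t * p y"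
    using sublinear_add[OF assms, of "z + t *\<^sub>R y" "- z"] sublinear_scaleR[OF assms, of t y]
    by simp
qed

lemma lowered_le: "sublinear p \<Longrightarrow> 0 \<le> t \<Longrightarrow> lowered p y z \<le> p (z + t *\<^sub>R y) - t * p y"
  unfolding lowered_def by (rule cINF_lower[OF lowered_bdd]) auto

lemma lowered_le_self: "sublinear p \<Longrightarrow> lowered p y z \<le> p z"
  using lowered_le[of p 0 y z] by simp

lemma lowered_minus: "sublinear p \<Longrightarrow> lowered p y (- y) \<le> - p y"
  using lowered_le[of p 1 y "- y"] sublinear_zero[of p] by simp

lemma lowered_approx:
  assumes "sublinear p" "e > 0"
  obtains t where "0 \<le> t" "p (z + t *\<^sub>R y) - t * p y < lowered p y z + e"
proof -
  have "\<exists>t\<in>{0..}. p (z + t *\<^sub>R y) - t * p y < lowered p y z + e"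
    using assms(2) cINF_less_iff[OF _ lowered_bdd[OF assms(1)], of z y "lowered p y z + e"]
    unfolding lowered_def by auto
  then show ?thesis using that by auto
qed

text \<open>Near-optimal parameters s for u and t for v give the admissible parameter s + t for u +
  v; scaling by r turns t into r t.\<close>

lemma sublinear_lowered:
  assumes "sublinear p"
  shows "sublinear (lowered p y)"
  unfolding sublinear_def
proof (intro conjI allI impI)
  fix u v
  show "lowered p y (u + v) \<le> lowered p y u + lowered p y v"
  proof (rule field_le_epsilon)
    fix e :: real assume e: "0 < e"
    obtain s where s: "0 \<le> s" "p (u + s *\<^sub>R y) - s * p y < lowered p y u + e / 2"
      using lowered_approx[OF assms, of "e/2"] e by auto
    obtain t where t: "0 \<le> t" "p (v + t *\<^sub>R y) - t * p y < lowered p y v + e / 2"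
      using lowered_approx[OF assms, of "e/2"] e by auto
    have "lowered p y (u + v) \<le> p ((u + v) + (s + t) *\<^sub>R y) - (s + t) * p y"
      using s t by (intro lowered_le[OF assms]) simp
    also have "(u + v) + (s + t) *\<^sub>R y = (u + s *\<^sub>R y) + (v + t *\<^sub>R y)"
      by (simp add: algebra_simps)
    finally show "lowered p y (u + v) \<le> lowered p y u + lowered p y v + e"
      using s t sublinear_add[OF assms, of "u + s *\<^sub>R y" "v + t *\<^sub>R y"] by (simp add: algebra_simps)
  qed
next
  fix r :: real and u
  assume r: "0 < r"
  have "lowered p y (r *\<^sub>R u) / r \<le> lowered p y u"
    unfolding lowered_def[of p y u]
  proof (rule cINF_greatest)
    fix t :: real assume t: "t \<in> {0..}"
    have "lowered p y (r *\<^sub>R u) \<le> p (r *\<^sub>R u + (r * t) *\<^sub>R y) - r * t * p y"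
      using r t by (intro lowered_le[OF assms]) simp
    also have "r *\<^sub>R u + (r * t) *\<^sub>R y = r *\<^sub>R (u + t *\<^sub>R y)"
      by (simp add: algebra_simps)
    finally show "lowered p y (r *\<^sub>R u) / r \<le> p (u + t *\<^sub>R y) - t * p y"
      using r sublinear_scaleR[OF assms, of r "u + t *\<^sub>R y"] by (simp add: field_simps)
  qed simp
  then show "lowered p y (r *\<^sub>R u) \<le> r * lowered p y u"
    using r by (simp add: field_simps)
qed

text \<open>Lowering \<open>p\<close> in any direction y stays below \<open>p\<close>, so by
  minimality it changes nothing. This makes \<open>p\<close> odd, and an odd sublinear functional is
  linear.\<close>

lemma minimal_sublinear_linear:
  assumes p: "sublinear p" and min: "\<And>q. sublinear q \<Longrightarrow> q \<le> p \<Longrightarrow> q = p"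
  shows "linear p"
proof -
  have neg: "p (- y) = - p y" for y
  proof -
    have "lowered p y = p"
      by (rule min) (auto simp: le_fun_def p sublinear_lowered lowered_le_self)
    then have "p (- y) \<le> - p y"
      using lowered_minus[OF p, of y] by simp
    then show ?thesis using sublinear_minus[OF p, of y] by simp
  qed
  show ?thesis
  proof (rule linearI)
    fix u v
    \<comment> \<open>By oddness, subadditivity at -u and -v is superadditivity at u and v.\<close>
    have "p (- u + - v) \<le> p (- u) + p (- v)" by (rule sublinear_add[OF p])
    moreover have "p (- u + - v) = - p (u + v)" using neg[of "u + v"] by simp
    ultimately show "p (u + v) = p u + p v"
      using sublinear_add[OF p, of u v] neg by simp
  next
    fix r u
    show "p (r *\<^sub>R u) = r *\<^sub>R p u"
    proof (cases "0 \<le> r")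
      case True
      then show ?thesis using sublinear_scaleR[OF p] by simp
    next
      case False
      then show ?thesis
        using sublinear_scaleR[OF p, of "- r" u] neg[of "r *\<^sub>R u"] by simp
    qed
  qed
qed

text \<open>Of two members of the chain that are near-optimal at u and at v, the smaller one is
  near-optimal at both, so its subadditivity passes to the infimum.\<close>

lemma sublinear_chain_INF:
  assumes C: "C \<noteq> {}" "\<And>p. p \<in> C \<Longrightarrow> sublinear p" "\<And>p. p \<in> C \<Longrightarrow> p \<le> p0"
    and chain: "\<And>p q. p \<in> C \<Longrightarrow> q \<in> C \<Longrightarrow> p \<le> q \<or> q \<le> p"
  defines "m \<equiv> \<lambda>z. INF p\<in>C. p z"
  shows "sublinear m" and "\<And>p. p \<in> C \<Longrightarrow> m \<le> p"
proof -
  have bdd: "bdd_below ((\<lambda>p. p z) ` C)" for z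
  proof (rule bdd_belowI2)
    fix p assume "p \<in> C"
    \<comment> \<open>The upper bound \<open>p0\<close> also bounds from below: -p0(-z) \<le> -p(-z)
      \<le> p(z).\<close>
    then show "- p0 (- z) \<le> p z"
      using sublinear_minus[OF C(2), of p z] C(3)[of p] by (simp add: le_fun_def) (smt (verit))
  qed
  have m_le: "m z \<le> p z" if "p \<in> C" for p z
    unfolding m_def by (rule cINF_lower[OF bdd that])
  then show "\<And>p. p \<in> C \<Longrightarrow> m \<le> p" by (simp add: le_fun_def)
  have approx: "\<exists>p\<in>C. p z < m z + e" if "e > 0" for z e
    using that cINF_less_iff[OF C(1) bdd, of z "m z + e"] unfolding m_def by simp
  show "sublinear m"
    unfolding sublinear_def
  proof (intro conjI allI impI)
    fix u v
    show "m (u + v) \<le> m u + m v"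
    proof (rule field_le_epsilon)
      fix e :: real assume e: "0 < e"
      obtain p q where pq: "p \<in> C" "q \<in> C" "p u < m u + e / 2" "q v < m v + e / 2"
        using approx[of "e/2"] e by (meson half_gt_zero)
      obtain r where r: "r \<in> C" "r \<le> p" "r \<le> q"
        using chain[OF pq(1,2)] pq by blast
      then show "m (u + v) \<le> m u + m v + e"
        using m_le[OF r(1), of "u + v"] sublinear_add[OF C(2)[OF r(1)], of u v]
          le_funD[OF r(2), of u] le_funD[OF r(3), of v] pq by linarith
    qed
  next
    fix t :: real and u
    assume t: "0 < t"
    have "m (t *\<^sub>R u) / t \<le> (INF p\<in>C. p u)"
    proof (rule cINF_greatest[OF C(1)])
      fix p assume p: "p \<in> C"
      then show "m (t *\<^sub>R u) / t \<le> p u"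
        using m_le[of p "t *\<^sub>R u"] sublinear_scaleR_le[OF C(2)[OF p] t, of u] t
        by (simp add: field_simps)
    qed
    then show "m (t *\<^sub>R u) \<le> t * m u"
      unfolding m_def using t by (simp add: field_simps)
  qed
qed

lemma linear_below_sublinear:
  assumes p0: "sublinear p0"
  obtains f where "linear f" "f \<le> p0"
proof -
  define A where "A = {p. sublinear p \<and> p \<le> p0}"
  \<comment> \<open>The order is reversed, so that a maximal element in Zorn's lemma is a minimal
    functional.\<close>
  let ?P = "\<lambda>p q :: 'a \<Rightarrow> real. q \<le> p"
  have "\<exists>m\<in>A. \<forall>p\<in>A. ?P m p \<longrightarrow> p = m"
  proof (rule predicate_Zorn)
    show "partial_order_on A (relation_of ?P A)"
      by (rule partial_order_on_relation_ofI) auto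
  next
    fix C assume "C \<in> Chains (relation_of ?P A)"
    then have sub: "C \<subseteq> A" and chain: "\<And>p q. p \<in> C \<Longrightarrow> q \<in> C \<Longrightarrow> p \<le> q \<or> q \<le> p"
      by (auto simp: Chains_def relation_of_def)
    show "\<exists>m\<in>A. \<forall>p\<in>C. ?P p m"
    proof (cases "C = {}")
      case True
      then show ?thesis using p0 by (auto simp: A_def)
    next
      case False
      let ?m = "\<lambda>z. INF p\<in>C. p z"
      have "sublinear ?m" and le: "\<And>p. p \<in> C \<Longrightarrow> ?m \<le> p"
        using sublinear_chain_INF[OF False _ _ chain, of p0] sub by (auto simp: A_def)
      moreover obtain p where "p \<in> C" "p \<le> p0"
        using False sub by (auto simp: A_def)
      then have "?m \<le> p0"
        using le order_trans by blast
      ultimately show ?thesis unfolding A_def by blast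
    qed
  qed
  \<comment> \<open>Anything sublinear below \<open>m\<close> is below \<open>p0\<close> and hence
    in \<open>A\<close>, so \<open>m\<close> is minimal among all sublinear functionals.\<close>
  then obtain m where m: "sublinear m" "m \<le> p0" "\<And>q. sublinear q \<Longrightarrow> q \<le> m \<Longrightarrow> q = m"
    unfolding A_def by (auto intro: order_trans)
  then show ?thesis using that minimal_sublinear_linear by blast
qed

text \<open>Lowering the norm in direction x first forces f(-x) \<le> -norm x, which together with f
  \<le> norm fixes the value at x.\<close>

lemma real_support_functional:
  fixes x :: "'a::real_normed_vector"
  obtains f where "linear f" "\<And>z. f z \<le> norm z" "f x = norm x"
proof -
  obtain f where f: "linear f" "f \<le> lowered norm x"
    using linear_below_sublinear[OF sublinear_lowered[OF sublinear_norm]] .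
  have le: "f z \<le> norm z" for z
    using le_funD[OF f(2), of z] lowered_le_self[OF sublinear_norm, of x z] by simp
  have "f (- x) \<le> - norm x"
    using le_funD[OF f(2), of "- x"] lowered_minus[OF sublinear_norm, of x] by simp
  then have "f x = norm x"
    using le[of x] linear_neg[OF f(1), of x] by simp
  then show ?thesis using that f(1) le by blast
qed

section \<open>Numerical radii and the parallel pair, uniformly in the scalar field\<close>

context normed_space_over
begin

text \<open>This gives access to \<open>bounded_linear\<close> and \<open>onorm\<close>, which
  concern real-linear maps.\<close>

lemma real_linear_of_linear:
  assumes "Vector_Spaces.linear scale (*) f"
  shows "linear f"
proof -
  interpret f: Vector_Spaces.linear scale "(*)" f by fact
  show ?thesis
    by (rule linearI) (simp_all add: f.add f.scale scaleR_conv_of_real flip: scale_of_real)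
qed

lemma dual_bounded_linear: "f \<in> dual \<Longrightarrow> bounded_linear f"
  unfolding dual_def
  by (auto simp: bounded_linear_def bounded_linear_axioms_def intro: real_linear_of_linear)

lemma support_functional_linear:
  "f \<in> support_functionals x \<Longrightarrow> Vector_Spaces.linear scale (*) f"
  by (simp add: support_functionals_def dual_def)

lemma support_functional_le: "f \<in> support_functionals x \<Longrightarrow> norm (f z) \<le> norm z"
  using onorm[OF dual_bounded_linear, of f z] by (simp add: support_functionals_def)

lemma support_functionalI:
  assumes lin: "Vector_Spaces.linear scale (*) f" and le: "\<And>z. norm (f z) \<le> norm z"
    and x: "f x = of_real (norm x)" "x \<noteq> 0"
  shows "f \<in> support_functionals x"
proof -
  have "f \<in> dual"
    unfolding dual_def using lin le by (auto intro!: exI[of _ 1])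
  moreover have "onorm f = 1"
  proof (rule antisym)
    show "onorm f \<le> 1" by (rule onorm_bound) (simp_all add: le)
    show "1 \<le> onorm f"
      using le_onorm[OF dual_bounded_linear[OF \<open>f \<in> dual\<close>], of x] x by simp
  qed
  ultimately show ?thesis using x by (simp add: support_functionals_def)
qed

text \<open>The operators below attain their numerical radius, so the supremum is computed as a
  maximum.\<close>

lemma numerical_radius_eq:
  assumes "norm x = 1" "f \<in> support_functionals x" "norm (f (T x)) = r"
    and "\<And>y g. norm y = 1 \<Longrightarrow> g \<in> support_functionals y \<Longrightarrow> norm (g (T y)) \<le> r"
  shows "numerical_radius T = r"
  unfolding numerical_radius_def
  by (rule cSup_eq_maximum) (use assms in blast)+

lemma exists_independent_pair:
  assumes "dimension_at_least 2"
  obtains u v where "u \<noteq> v" "independent {u, v}"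
proof -
  obtain B where B: "independent B" "infinite B \<or> 2 \<le> card B"
    using assms unfolding dimension_at_least_def by blast
  \<comment> \<open>An infinite basis has \<open>card\<close> 0 and is covered by
    \<open>infinite_arbitrarily_large\<close>.\<close>
  obtain C where C: "C \<subseteq> B" "card C = 2"
    using B(2) by (metis infinite_arbitrarily_large obtain_subset_with_card_n)
  then show ?thesis
    using that independent_mono[OF B(1)] by (auto simp: card_2_iff)
qed

text \<open>Existence of support functionals is a hypothesis because its proof depends on the scalar
  field.\<close>

lemma parallel_independent_pair:
  assumes dim: "dimension_at_least 2"
    and support: "\<And>x. x \<noteq> 0 \<Longrightarrow> support_functionals x \<noteq> {}"
  shows "\<exists>T\<in>bounded_operators. \<exists>S\<in>bounded_operators.
    linearly_independent_pair T S \<and> numerical_radius_parallel T S"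
proof -
  obtain u v where uv: "u \<noteq> v" "independent {u, v}"
    using exists_independent_pair[OF dim] .
  have indep: "a = 0" if "scale a v = scale b u" for a b
  proof (rule ccontr)
    assume "a \<noteq> 0"
    then have "v = scale (inverse a) (scale a v)" by simp
    also have "\<dots> = scale (inverse a * b) u" by (simp only: that scale_scale)
    finally have "v \<in> span {u}" by (metis span_base span_scale singletonI)
    moreover have "v \<notin> span {u}"
      using uv independent_insert[of v "{u}"] by (simp add: insert_commute)
    ultimately show False by blast
  qed
  have "u \<noteq> 0" using uv(2) dependent_zero by auto
  define x where "x = scale (of_real (1 / norm u)) u"
  have x: "norm x = 1" using \<open>u \<noteq> 0\<close> by (simp add: x_def scale_of_real del: of_real_divide)
  then have "x \<noteq> 0" by auto
  then obtain f where f: "f \<in> support_functionals x" using support by blast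
  interpret f: Vector_Spaces.linear scale "(*)" f by (rule support_functional_linear[OF f])
  have fx: "f x = 1" using f x by (simp add: support_functionals_def)
  define T :: "'a \<Rightarrow> 'a" where "T = (\<lambda>y. y)"
  define S where "S = (\<lambda>y. scale (f y) x)"
  have T_bdd: "T \<in> bounded_operators"
    unfolding bounded_operators_def T_def using linear_ident by (auto intro!: exI[of _ 1])
  have "Vector_Spaces.linear scale scale S"
    unfolding S_def by unfold_locales (simp_all add: f.add f.scale scale_left_distrib)
  then have S_bdd: "S \<in> bounded_operators"
    unfolding bounded_operators_def using support_functional_le[OF f]
    by (auto intro!: exI[of _ 1] simp: S_def norm_scale x)
  have "linearly_independent_pair T S"
    unfolding linearly_independent_pair_def
  proof (intro allI impI)
    fix a b assume eq: "\<forall>y. scale a (T y) + scale b (S y) = 0"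
    \<comment> \<open>At v the rank-one term is a multiple of u, so it cannot cancel a nonzero
      multiple of v.\<close>
    then have "scale a v = scale (- (b * f v * of_real (1 / norm u))) u"
      by (simp add: T_def S_def x_def eq_neg_iff_add_eq_0 mult.assoc)
    then have "a = 0" by (rule indep)
    moreover have "scale b x = 0" using eq[rule_format, of x] \<open>a = 0\<close> by (simp add: S_def fx)
    ultimately show "a = 0 \<and> b = 0" using \<open>x \<noteq> 0\<close> by simp
  qed
  moreover have "numerical_radius_parallel T S"
  proof -
    have T_le: "norm (g (T y)) \<le> 1" if "norm y = 1" "g \<in> support_functionals y" for y g
      using support_functional_le[OF that(2), of y] that(1) by (simp add: T_def)
    \<comment> \<open>Here |g(S y)| \<le> norm (S y) = |f y| \<le> 1.\<close>
    have S_le: "norm (g (S y)) \<le> 1" if "norm y = 1" "g \<in> support_functionals y" for y g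
      using support_functional_le[OF that(2), of "S y"] support_functional_le[OF f, of y] that(1)
      by (simp add: S_def norm_scale x)
    have "numerical_radius T = 1"
      by (rule numerical_radius_eq[OF x f]) (simp_all add: T_le, simp add: T_def fx)
    moreover have "numerical_radius S = 1"
      by (rule numerical_radius_eq[OF x f]) (simp_all add: S_le, simp add: S_def fx)
    moreover have "numerical_radius (\<lambda>y. T y + scale 1 (S y)) = 2"
    proof (rule numerical_radius_eq[OF x f])
      show "norm (f (T x + scale 1 (S x))) = 2" by (simp add: T_def S_def f.add fx)
      fix y g assume y: "norm y = 1" and g: "g \<in> support_functionals y"
      interpret g: Vector_Spaces.linear scale "(*)" g by (rule support_functional_linear[OF g])
      show "norm (g (T y + scale 1 (S y))) \<le> 2"
        using norm_triangle_ineq[of "g (T y)" "g (S y)"] T_le[OF y g] S_le[OF y g]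
        by (simp add: g.add)
    qed
    ultimately show ?thesis
      unfolding numerical_radius_parallel_def by (intro exI[of _ 1]) simp
  qed
  ultimately show ?thesis using T_bdd S_bdd by blast
qed

end

section \<open>Existence of support functionals over the real and the complex scalars\<close>

lemma support_functional_real:
  fixes scale :: "real \<Rightarrow> 'a::real_normed_vector \<Rightarrow> 'a"
  assumes "normed_space_over scale" "x \<noteq> 0"
  shows "normed_space_over.support_functionals scale x \<noteq> {}"
proof -
  interpret normed_space_over scale by fact
  obtain f where f: "linear f" "\<And>z. f z \<le> norm z" "f x = norm x"
    using real_support_functional[of x] by blast
  have "f \<in> support_functionals x"
  proof (rule support_functionalI)
    show "Vector_Spaces.linear scale (*) f"
      by unfold_locales
        (use scale_of_real linear_add[OF f(1)] linear_scale[OF f(1)]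
          in \<open>simp_all add: distrib_left distrib_right\<close>)
    show "norm (f z) \<le> norm z" for z
      using f(2)[of z] f(2)[of "- z"] by (simp add: linear_neg[OF f(1)] abs_le_iff)
  qed (use f(3) assms(2) in simp_all)
  then show ?thesis by blast
qed

lemma support_functional_complex:
  fixes scale :: "complex \<Rightarrow> 'a::real_normed_vector \<Rightarrow> 'a"
  assumes "normed_space_over scale" "x \<noteq> 0"
  shows "normed_space_over.support_functionals scale x \<noteq> {}"
proof -
  interpret normed_space_over scale by fact
  obtain f where f: "linear f" "\<And>z. f z \<le> norm z" "f x = norm x"
    using real_support_functional[of x] by blast
  \<comment> \<open>The complex-linear functional with real part f: g(z) = f(z) - i f(iz).\<close>
  define g where "g z = Complex (f z) (- f (scale \<i> z))" for z
  have f_scale: "f (scale c z) = Re c * f z + Im c * f (scale \<i> z)" for c z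
  proof -
    have "scale c z = scale (of_real (Re c)) z + scale (of_real (Im c)) (scale \<i> z)"
      by (subst complex_eq[of c]) (simp only: scale_left_distrib scale_scale mult.commute)
    then show ?thesis
      by (simp only: scale_of_real linear_add[OF f(1)] linear_scale[OF f(1)]) simp
  qed
  \<comment> \<open>The instance at c gives the real part, the one at ic the imaginary part.\<close>
  have g_scale: "g (scale c z) = c * g z" for c z
    using f_scale[of c z] f_scale[of "\<i> * c" z] by (simp add: g_def complex_eq_iff)
  have g_le: "norm (g z) \<le> norm z" for z
  proof -
    \<comment> \<open>Multiplication by c rotates g z onto the nonnegative real axis, where g agrees
      with f. If g z = 0 then c = 0, so in general only norm c \<le> 1 holds.\<close>
    define c where "c = cnj (sgn (g z))"
    have "norm (g z) = Re (c * g z)"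
      by (simp add: c_def sgn_eq mult.commute[of "cnj _"] complex_norm_square[symmetric] power2_eq_square)
    also have "\<dots> = f (scale c z)"
      by (simp flip: g_scale) (simp add: g_def)
    also have "\<dots> \<le> norm c * norm z"
      using f(2)[of "scale c z"] by (simp add: norm_scale)
    also have "\<dots> \<le> norm z"
      by (simp add: c_def norm_sgn)
    finally show ?thesis .
  qed
  have "g \<in> support_functionals x"
  proof (rule support_functionalI)
    have "g (u + v) = g u + g v" for u v
      by (simp add: g_def linear_add[OF f(1)] scale_right_distrib complex_eq_iff)
    then show "Vector_Spaces.linear scale (*) g"
      by unfold_locales (simp_all add: g_scale distrib_left distrib_right)
    \<comment> \<open>The real part of g x is already norm x, so the norm bound leaves no room for
      an imaginary part.\<close>
    have "(norm x)\<^sup>2 + (Im (g x))\<^sup>2 \<le> (norm x)\<^sup>2"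
      using power_mono[OF g_le[of x] norm_ge_zero, of 2] by (simp add: cmod_power2 g_def f(3))
    then show "g x = of_real (norm x)"
      by (simp add: complex_eq_iff) (simp add: g_def f(3))
  qed (use g_le assms(2) in simp_all)
  then show ?thesis by blast
qed

theorem theorem6:
  fixes scale_real :: "real \<Rightarrow> 'a::real_normed_vector \<Rightarrow> 'a"
    and scale_complex :: "complex \<Rightarrow> 'b::real_normed_vector \<Rightarrow> 'b"
  shows
   "(normed_space_over scale_real \<and> normed_space_over.dimension_at_least scale_real 2 \<longrightarrow>
      (\<exists>T \<in> normed_space_over.bounded_operators scale_real.
       \<exists>S \<in> normed_space_over.bounded_operators scale_real.
         normed_space_over.linearly_independent_pair scale_real T S \<and>
         normed_space_over.numerical_radius_parallel scale_real T S)) \<and>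
    (normed_space_over scale_complex \<and> normed_space_over.dimension_at_least scale_complex 2 \<longrightarrow>
      (\<exists>T \<in> normed_space_over.bounded_operators scale_complex.
       \<exists>S \<in> normed_space_over.bounded_operators scale_complex.
         normed_space_over.linearly_independent_pair scale_complex T S \<and>
         normed_space_over.numerical_radius_parallel scale_complex T S))"
  by (intro conjI impI; elim conjE; rule normed_space_over.parallel_independent_pair)
    (auto dest: support_functional_real support_functional_complex)

end
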